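(* Let $X_{1},\ldots,X_{n}$ be independent random variables such that, for each $i$, $b_i>0$, $\mathbb{P}(X_i\in[0,b_i])=1$ and $\mathbb{P}(X_{i}>0)>0$. Let $S_{n}=\sum_{i=1}^{n}X_{i}$ and let $p\geq 1$ be an integer. Write $\mu_{i}^{k}=\mathbb{E}(X_{i}^{k})$, $d(X_{i})=\left(\mu_{i}^{2}/\mu_{i}^{1}\right)^{2}$ and $D_{n}=\sum_{j=1}^{n}d(X_{j})$. For $i=1,\ldots,n$ and $y>0$ let $$C_{p}\left(y,b_{i},\mu_{i}^{1},\ldots,\mu_{i}^{p}\right)=\left(\frac{\mu_{i}^{p}\exp(y)+\sum_{j=0}^{p-3}\frac{y^{j}}{j!}\left(b_{i}^{p-j-2}\mu_{i}^{j+2}-\mu_{i}^{p}\right)}{\mu_{i}^{p}\exp(y)+\sum_{j=0}^{p-2}\frac{y^{j}}{j!}\left(b_{i}^{p-j-1}\mu_{i}^{j+1}-\mu_{i}^{p}\right)}\right)^{2}.$$ (i) For all $t>0$, $$\mathbb{P}(S_{n}-\mathbb{E}(S_{n})\geq t)\leq\exp\left(-\frac{2t^{2}}{\sum_{i=1}^{n}b_{i}^{2}\,C_{p}\left(4tb_{i}/D_{n},b_{i},\mu_{i}^{1},\ldots,\mu_{i}^{p}\right)}\right).$$ (ii) For every integer $p\geq 1$, every $i=1,\ldots,n$ and every $y>0$ we have $0<C_{p}(y,b_{i},\mu_{i}^{1},\ldots,\mu_{i}^{p})\leq 1$. Thus, the bound in (i) is at least as tight as (its right-hand side is at most that of) Hoeffding's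 inequality $$\mathbb{P}(S_{n}-\mathbb{E}(S_{n})\geq t)\leq\exp\left(-\frac{2t^{2}}{\sum_{i=1}^{n}b_{i}^{2}}\right),$$ which corresponds to the case $p=1$, for which $C_{1}=1$.
   Context: The superscript $k$ in $\mu_i^k$ is an index (order of the moment), not a power; $(\cdot)^2$ applied to a parenthesized expression is a square. A sum $\sum_{j=0}^{m}$ with $m<0$ is $0$, and $y^0=1$. *)

theory Defs
  imports "HOL-Probability.Probability"
begin

definition moment :: "'a measure \<Rightarrow> ('a \<Rightarrow> real) \<Rightarrow> nat \<Rightarrow> real" where
  "moment M X k = prob_space.expectation M (\<lambda>\<omega>. X \<omega> ^ k)"

definition d_coeff :: "'a measure \<Rightarrow> ('a \<Rightarrow> real) \<Rightarrow> real" where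
  "d_coeff M X = (moment M X 2 / moment M X 1)\<^sup>2"

(* The sequence m holds the moments; only m 1, ..., m p occur. For p \<ge> 1 the index sets
   {..<p - 2} and {..<p - 1} are {0..p - 3} and {0..p - 2}, read as empty when the upper
   bound is negative. On them the natural-number subtractions in the exponents never truncate. *)
definition C_coeff :: "nat \<Rightarrow> real \<Rightarrow> real \<Rightarrow> (nat \<Rightarrow> real) \<Rightarrow> real" where
  "C_coeff p y b m =
     ((m p * exp y + (\<Sum>j<p - 2. y ^ j / fact j * (b ^ (p - j - 2) * m (j + 2) - m p))) /
      (m p * exp y + (\<Sum>j<p - 1. y ^ j / fact j * (b ^ (p - j - 1) * m (j + 1) - m p))))\<^sup>2"

end

theory Submission
  imports Defs
begin

text \<open>
  Let \<open>X\<close> take values in \<open>[0, b]\<close>, put \<open>Z = X / b\<close>, and let \<open>a k\<close> be the moment of \<open>Z\<close> of order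
  \<open>min k p\<close>. Since \<open>0 \<le> Z \<le> 1\<close>, the powers of \<open>Z\<close> beyond the \<open>p\<close>-th are at most \<open>Z ^ p\<close>; applied
  to the exponential series this bounds the moment generating function of \<open>Z\<close> at \<open>y \<ge> 0\<close> by
  \<open>v y = (\<Sum>k. a k * y ^ k / k!)\<close>, which involves only the first \<open>p\<close> moments
  (\<open>mgf_le_egf_capped_moment\<close>). Differentiating such an exponential generating function shifts
  its coefficients, and computing \<open>v'\<close> and \<open>v''\<close> in closed form shows that \<open>C_coeff p y\<close> is exactly
  \<open>(v'' y / v' y)\<^sup>2\<close> (\<open>C_coeff_eq_deriv_ratio\<close>).

  This identity explains the exponent. With \<open>x = v' / v\<close> and \<open>r = v'' / v'\<close> one has
  \<open>(ln v)'' = x * (r - x) \<le> r\<^sup>2 / 4\<close>. By the Cauchy-Schwarz inequality the moments form a log-convex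
  sequence, and capping the order at \<open>p\<close> keeps it log-convex because the moments of \<open>Z\<close> decrease.
  Log-convexity makes \<open>r\<close> increasing (\<open>egf_ratio_mono\<close>, a Chebyshev sum argument), so on
  \<open>[0, y]\<close> the second derivative of \<open>ln v\<close> is at most \<open>(r y)\<^sup>2 / 4\<close>, and Taylor's theorem gives
  \<open>ln (v y) \<le> a 1 * y + y\<^sup>2 / 8 * (r y)\<^sup>2\<close> (\<open>egf_le_exp\<close>). Hence \<open>X\<close> satisfies Hoeffding's lemma with
  \<open>b\<^sup>2\<close> replaced by \<open>b\<^sup>2 * C_coeff p (s * b)\<close> (\<open>centered_mgf_le\<close>).

  For the sum, write \<open>C i\<close> for the coefficient of \<open>X i\<close> at \<open>4 * t * b i / D\<close> and
  \<open>A = (\<Sum>i. (b i)\<^sup>2 * C i)\<close>. Chernoff's bound at \<open>s = 4 * t / A\<close> yields \<open>exp (- 2 * t\<^sup>2 / A)\<close> once the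
  coefficients at \<open>s * b i\<close> are bounded by those at \<open>4 * t * b i / D\<close>. The latter points are at
  least as large because \<open>A \<ge> D\<close>: the coefficient at any \<open>y \<ge> 0\<close> is at least its value at \<open>0\<close>, which is
  \<open>d (X i) / (b i)\<^sup>2\<close> when \<open>p \<ge> 2\<close> and \<open>1\<close> when \<open>p = 1\<close>, and \<open>d (X i) \<le> (b i)\<^sup>2\<close>. Monotonicity of the
  coefficients then closes the argument. Finally \<open>v'' \<le> v'\<close>, again because the moments of \<open>Z\<close>
  decrease, so every coefficient is at most \<open>1\<close> and the bound improves on Hoeffding's.
\<close>

section \<open>Exponential generating functions\<close>

definition egf :: "(nat \<Rightarrow> real) \<Rightarrow> real \<Rightarrow> real" where
  "egf a y = (\<Sum>k. a k / fact k * y ^ k)"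

lemma egf_summable:
  fixes a :: "nat \<Rightarrow> real"
  assumes "\<And>k. \<bar>a k\<bar> \<le> K"
  shows "summable (\<lambda>k. a k / fact k * y ^ k)"
proof (rule summable_comparison_test')
  show "norm (a k / fact k * y ^ k) \<le> K * (inverse (fact k) * \<bar>y\<bar> ^ k)" if "0 \<le> k" for k
    using assms[of k] by (auto simp: abs_mult power_abs divide_simps intro!: mult_right_mono)
  show "summable (\<lambda>k. K * (inverse (fact k) * \<bar>y\<bar> ^ k))"
    by (intro summable_mult summable_exp)
qed

lemma egf_0 [simp]: "egf a 0 = a 0"
  using powser_zero[of "\<lambda>k. a k / fact k"] by (simp add: egf_def)

lemma egf_has_derivative:
  assumes "\<And>k. \<bar>a k\<bar> \<le> K"
  shows "(egf a has_real_derivative egf (\<lambda>k. a (Suc k)) y) (at y)"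
proof -
  have "diffs (\<lambda>k. a k / fact k) = (\<lambda>k. a (Suc k) / fact k)"
    by (rule ext) (simp add: diffs_def fact_reduce divide_simps del: of_nat_Suc)
  thus ?thesis
    using termdiffs_strong_converges_everywhere[OF egf_summable[of a K, OF assms], of y]
    unfolding egf_def by simp
qed

lemma egf_mono:
  assumes "\<And>k. \<bar>a k\<bar> \<le> K" "\<And>k. \<bar>a' k\<bar> \<le> K'" "\<And>k. a k \<le> a' k" "0 \<le> y"
  shows "egf a y \<le> egf a' y"
  unfolding egf_def
  by (intro suminf_le egf_summable[of a K] egf_summable[of a' K'] mult_right_mono divide_right_mono)
     (use assms in auto)

lemma egf_pos:
  assumes "\<And>k. \<bar>a k\<bar> \<le> K" "\<And>k. 0 < a k" "0 \<le> y"
  shows "0 < egf a y"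
proof -
  have "(\<Sum>k<1. a k / fact k * y ^ k) \<le> egf a y"
    unfolding egf_def
    by (intro sum_le_suminf egf_summable[of a K]) (use assms in \<open>auto simp: less_imp_le\<close>)
  thus ?thesis using assms(2)[of 0] by simp
qed

text \<open>
  Comparing the coefficients with the constant sequence \<open>c\<close> leaves only finitely many
  correction terms. This is the shape of the numerator and the denominator of \<open>C_coeff\<close>.
\<close>
lemma egf_eventually_const:
  assumes "\<And>k. N \<le> k \<Longrightarrow> a k = c"
  shows "egf a y = c * exp y + (\<Sum>k<N. y ^ k / fact k * (a k - c))"
proof -
  have "(\<lambda>k. c * (y ^ k /\<^sub>R fact k)) sums (c * exp y)"
    by (intro sums_mult exp_converges)
  moreover have "(\<lambda>k. y ^ k / fact k * (a k - c)) sums (\<Sum>k<N. y ^ k / fact k * (a k - c))"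
    by (rule sums_finite) (use assms in auto)
  ultimately have "(\<lambda>k. c * (y ^ k /\<^sub>R fact k) + y ^ k / fact k * (a k - c)) sums
      (c * exp y + (\<Sum>k<N. y ^ k / fact k * (a k - c)))"
    by (rule sums_add)
  moreover have "(\<lambda>k. c * (y ^ k /\<^sub>R fact k) + y ^ k / fact k * (a k - c)) =
      (\<lambda>k. a k / fact k * y ^ k)"
    by (rule ext) (simp add: field_simps)
  ultimately show ?thesis unfolding egf_def by (simp add: sums_iff)
qed

text \<open>
  Log-convexity says that consecutive quotients \<open>a (Suc k) / a k\<close> increase; comparing two of them
  at arbitrary positions is the cross-multiplied form below.
\<close>
lemma log_convex_cross_le:
  fixes a :: "nat \<Rightarrow> real"
  assumes pos: "\<And>k. 0 < a k" and conv: "\<And>k. (a (Suc k))\<^sup>2 \<le> a k * a (Suc (Suc k))"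
    and "j \<le> i"
  shows "a (Suc j) * a i \<le> a (Suc i) * a j"
  using \<open>j \<le> i\<close>
proof (induction i rule: dec_induct)
  case (step i)
  have "a (Suc j) * a (Suc i) * a i \<le> a (Suc i) * (a (Suc i) * a j)"
    using mult_left_mono[OF step.IH, of "a (Suc i)"] pos[of "Suc i"] by (simp add: mult_ac)
  also have "\<dots> \<le> a (Suc (Suc i)) * a j * a i"
    using mult_right_mono[OF conv[of i], of "a j"] pos[of j] by (simp add: power2_eq_square mult_ac)
  finally show ?case using pos[of i] by simp
qed simp

lemma power_cross_le:
  fixes x y :: real
  assumes "0 \<le> x" "x \<le> y" "j \<le> i"
  shows "x ^ i * y ^ j \<le> y ^ i * x ^ j"
proof -
  have "x ^ (i - j) * (x ^ j * y ^ j) \<le> y ^ (i - j) * (x ^ j * y ^ j)"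
    using assms by (intro mult_right_mono power_mono) auto
  moreover have "x ^ i = x ^ (i - j) * x ^ j" "y ^ i = y ^ (i - j) * y ^ j"
    using assms by (simp_all flip: power_add)
  ultimately show ?thesis by (simp add: mult_ac)
qed

text \<open>
  The quotient is a weighted mean of the increasing sequence \<open>a (Suc k) / a k\<close> with weights
  \<open>a k * z ^ k / k!\<close>, and a larger \<open>z\<close> moves weight towards larger \<open>k\<close>. The proof makes this precise
  for partial sums: symmetrizing the double sum turns each summand into a product of two
  differences that are both nonnegative for \<open>i \<ge> j\<close> and both nonpositive for \<open>i \<le> j\<close>.
\<close>
lemma egf_ratio_mono:
  assumes bd: "\<And>k. \<bar>a k\<bar> \<le> K" and pos: "\<And>k. 0 < a k"
    and conv: "\<And>k. (a (Suc k))\<^sup>2 \<le> a k * a (Suc (Suc k))"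
    and xy: "0 \<le> x" "x \<le> y"
  shows "egf (\<lambda>k. a (Suc k)) x / egf a x \<le> egf (\<lambda>k. a (Suc k)) y / egf a y"
proof -
  define w where "w = (\<lambda>z k. z ^ k / fact k :: real)"
  define F where "F = (\<lambda>N z. \<Sum>k<N. a k * w z k)"
  define G where "G = (\<lambda>N z. \<Sum>k<N. a (Suc k) * w z k)"
  have partial: "G N x * F N y \<le> G N y * F N x" for N
  proof -
    let ?T = "\<lambda>i j. a (Suc i) * a j * (w y i * w x j - w x i * w y j)"
    have diff: "G N y * F N x - G N x * F N y = (\<Sum>i<N. \<Sum>j<N. ?T i j)"
      unfolding F_def G_def sum_product by (simp add: sum_subtractf algebra_simps)
    have "2 * (\<Sum>i<N. \<Sum>j<N. ?T i j) = (\<Sum>i<N. \<Sum>j<N. ?T i j) + (\<Sum>i<N. \<Sum>j<N. ?T j i)"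
      using sum.swap[of ?T "{..<N}" "{..<N}"] by simp
    also have "\<dots> = (\<Sum>i<N. \<Sum>j<N. (a (Suc i) * a j - a (Suc j) * a i) *
        (w y i * w x j - w x i * w y j))"
      by (simp add: algebra_simps flip: sum.distrib)
    also have "\<dots> \<ge> 0"
    proof (intro sum_nonneg)
      fix i j
      have w: "w x i * w y j \<le> w y i * w x j" if "j \<le> i" for i j
        using power_cross_le[OF xy that] by (simp add: w_def divide_right_mono)
      show "0 \<le> (a (Suc i) * a j - a (Suc j) * a i) * (w y i * w x j - w x i * w y j)"
        using log_convex_cross_le[of a, OF pos conv] w[of i j] w[of j i]
        by (cases "j \<le> i") (auto intro!: mult_nonneg_nonneg mult_nonpos_nonpos simp: mult.commute)
    qed
    finally show ?thesis using diff by simp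
  qed
  have "(\<lambda>N. F N z) \<longlonglongrightarrow> egf a z" for z
    using summable_LIMSEQ[OF egf_summable[of a K z, OF bd]] by (simp add: F_def w_def egf_def)
  moreover have "(\<lambda>N. G N z) \<longlonglongrightarrow> egf (\<lambda>k. a (Suc k)) z" for z
    using summable_LIMSEQ[OF egf_summable[of "\<lambda>k. a (Suc k)" K z, OF bd]]
    by (simp add: G_def w_def egf_def)
  ultimately have lim: "(\<lambda>N. G N u * F N v) \<longlonglongrightarrow> egf (\<lambda>k. a (Suc k)) u * egf a v" for u v
    by (intro tendsto_mult)
  have "egf (\<lambda>k. a (Suc k)) x * egf a y \<le> egf (\<lambda>k. a (Suc k)) y * egf a x"
    by (rule LIMSEQ_le[OF lim lim]) (use partial in blast)
  moreover have "0 < egf a x" "0 < egf a y"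
    using egf_pos[of a K, OF bd pos] xy by auto
  ultimately show ?thesis by (simp add: divide_simps)
qed

text \<open>
  If \<open>x\<close> is the logarithmic derivative of \<open>egf a\<close> and \<open>r\<close> that of its derivative, the second
  derivative of \<open>ln (egf a)\<close> is \<open>x * (r - x) \<le> r\<^sup>2 / 4\<close>, and on \<open>[0, y]\<close> the quotient \<open>r\<close> is largest at \<open>y\<close>.
  The bound is Taylor's theorem of order two at \<open>0\<close>, with the remainder estimated in this way.
  Since \<open>r\<close> compares the second derivative with the first, its monotonicity asks for log-convexity
  of the shifted sequence.
\<close>
lemma egf_le_exp:
  assumes bd: "\<And>k. \<bar>a k\<bar> \<le> K" and pos: "\<And>k. 0 < a k"
    and conv: "\<And>k. (a (Suc (Suc k)))\<^sup>2 \<le> a (Suc k) * a (Suc (Suc (Suc k)))"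
    and a0: "a 0 = 1" and y: "0 < y"
  defines "r \<equiv> \<lambda>z. egf (\<lambda>k. a (Suc (Suc k))) z / egf (\<lambda>k. a (Suc k)) z"
  shows "egf a y \<le> exp (a 1 * y + y\<^sup>2 / 8 * (r y)\<^sup>2)"
proof -
  define v0 where "v0 = egf a"
  define v1 where "v1 = egf (\<lambda>k. a (Suc k))"
  define v2 where "v2 = egf (\<lambda>k. a (Suc (Suc k)))"
  have v_pos: "0 < v0 z" "0 < v1 z" "0 < v2 z" if "0 \<le> z" for z
    unfolding v0_def v1_def v2_def using egf_pos[OF bd pos that] egf_pos[of _ K, OF bd pos that]
    by auto
  have [derivative_intros]:
    "(v0 has_real_derivative v1 z) (at z)" "(v1 has_real_derivative v2 z) (at z)" for z
    unfolding v0_def v1_def v2_def using egf_has_derivative[of _ K z, OF bd] by auto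
  define L1 where "L1 = (\<lambda>z. v1 z / v0 z)"
  define L2 where "L2 = (\<lambda>z. L1 z * (r z - L1 z))"
  define L where "L = (\<lambda>m. case m of 0 \<Rightarrow> (\<lambda>z. ln (v0 z)) | Suc 0 \<Rightarrow> L1 | _ \<Rightarrow> L2)"
  have "(L m has_real_derivative L (Suc m) z) (at z)" if "m < 2" "0 \<le> z" for m z
  proof -
    have "((\<lambda>z. ln (v0 z)) has_real_derivative L1 z) (at z)"
      using v_pos[OF that(2)] unfolding L1_def by (auto intro!: derivative_eq_intros)
    moreover have "(L1 has_real_derivative L2 z) (at z)"
      using v_pos[OF that(2)] unfolding L1_def L2_def r_def v2_def[symmetric] v1_def[symmetric]
      by (auto intro!: derivative_eq_intros simp: field_simps power2_eq_square)
    ultimately show ?thesis using that(1) by (auto simp: L_def less_2_cases_iff)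
  qed
  then obtain \<xi> where \<xi>: "0 < \<xi>" "\<xi> \<le> y"
    "ln (v0 y) = (\<Sum>m<2. L m 0 / fact m * y ^ m) + L 2 \<xi> / fact 2 * y\<^sup>2"
    using Maclaurin2[of y L "L 0" 2] y by (auto simp: L_def)
  have "r \<xi> \<le> r y"
    using egf_ratio_mono[of "\<lambda>k. a (Suc k)" K \<xi> y] bd pos conv \<xi> by (auto simp: r_def)
  moreover have "0 < r \<xi>"
    using v_pos[of \<xi>] \<xi> by (simp add: r_def v1_def v2_def)
  ultimately have "(r \<xi>)\<^sup>2 \<le> (r y)\<^sup>2" by (intro power_mono) auto
  moreover have "L 2 \<xi> \<le> (r \<xi>)\<^sup>2 / 4"
    using mult_const_minus_self_real_le[of "L1 \<xi>" "r \<xi>"] by (simp add: L_def L2_def numeral_2_eq_2)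
  ultimately have "L 2 \<xi> * y\<^sup>2 \<le> (r y)\<^sup>2 / 4 * y\<^sup>2"
    by (intro mult_right_mono) auto
  moreover have "(\<Sum>m<2. L m 0 / fact m * y ^ m) = a 1 * y"
    by (simp add: L_def L1_def v0_def v1_def a0 numeral_2_eq_2)
  ultimately have "ln (v0 y) \<le> a 1 * y + y\<^sup>2 / 8 * (r y)\<^sup>2"
    using \<xi>(3) by (simp add: mult.commute)
  thus ?thesis
    using v_pos(1)[of y] y by (metis exp_le_cancel_iff exp_ln less_imp_le v0_def)
qed

section \<open>Capped moments of a bounded nonnegative variable\<close>

locale nonneg_bounded_variable = prob_space M for M :: "'a measure" +
  fixes X :: "'a \<Rightarrow> real" and b :: real
  assumes measurable [measurable]: "X \<in> borel_measurable M"
    and b_pos: "0 < b"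
    and AE_bounds: "AE \<omega> in M. 0 \<le> X \<omega> \<and> X \<omega> \<le> b"
    and not_AE_0: "0 < prob {\<omega> \<in> space M. 0 < X \<omega>}"
begin

lemma integrable_power: "integrable M (\<lambda>\<omega>. X \<omega> ^ k)"
proof (rule integrable_const_bound[where B = "b ^ k"])
  show "AE \<omega> in M. norm (X \<omega> ^ k) \<le> b ^ k"
    using AE_bounds by eventually_elim (auto simp: power_abs intro!: power_mono)
qed simp

lemma integrable_exp: "integrable M (\<lambda>\<omega>. exp (s * X \<omega>))"
proof (rule integrable_const_bound[where B = "exp (\<bar>s\<bar> * b)"])
  show "AE \<omega> in M. norm (exp (s * X \<omega>)) \<le> exp (\<bar>s\<bar> * b)"
    using AE_bounds
  proof eventually_elim
    case (elim \<omega>)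
    have "s * X \<omega> \<le> \<bar>s\<bar> * X \<omega>" using elim by (intro mult_right_mono) auto
    also have "\<dots> \<le> \<bar>s\<bar> * b" using elim by (intro mult_left_mono) auto
    finally show ?case by simp
  qed
qed simp

lemma moment_pos: "0 < moment M X k"
proof -
  have "\<not> (AE \<omega> in M. X \<omega> ^ k = 0)"
  proof
    assume "AE \<omega> in M. X \<omega> ^ k = 0"
    hence "AE \<omega> in M. \<not> 0 < X \<omega>" by eventually_elim auto
    hence "prob {\<omega> \<in> space M. 0 < X \<omega>} = 0"
      by (subst prob_eq_0) auto
    with not_AE_0 show False by simp
  qed
  moreover have nonneg: "AE \<omega> in M. 0 \<le> X \<omega> ^ k" using AE_bounds by eventually_elim simp
  ultimately have "moment M X k \<noteq> 0"
    unfolding moment_def using integral_nonneg_eq_0_iff_AE[OF integrable_power] by blast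
  moreover have "0 \<le> moment M X k"
    unfolding moment_def using nonneg by (rule integral_nonneg_AE)
  ultimately show ?thesis by simp
qed

lemma moment_Suc_le: "moment M X (Suc k) \<le> b * moment M X k"
proof -
  have "moment M X (Suc k) \<le> expectation (\<lambda>\<omega>. b * X \<omega> ^ k)"
    unfolding moment_def
  proof (rule integral_mono_AE)
    show "AE \<omega> in M. X \<omega> ^ Suc k \<le> b * X \<omega> ^ k"
      using AE_bounds by eventually_elim (auto intro: mult_right_mono)
  qed (intro integrable_power integrable_mult_right)+
  thus ?thesis by (simp add: moment_def)
qed

text \<open>
  This is the Cauchy-Schwarz inequality for the measure with density \<open>X ^ k\<close>. The constant \<open>c\<close> below is
  the mean of \<open>X\<close> under the normalized measure, the point where the quadratic form is smallest.
\<close>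
lemma moment_log_convex: "(moment M X (Suc k))\<^sup>2 \<le> moment M X k * moment M X (Suc (Suc k))"
proof -
  define m where "m = moment M X"
  define c where "c = m (Suc k) / m k"
  have "0 \<le> expectation (\<lambda>\<omega>. X \<omega> ^ k * (X \<omega> - c)\<^sup>2)"
  proof (rule integral_nonneg_AE)
    show "AE \<omega> in M. 0 \<le> X \<omega> ^ k * (X \<omega> - c)\<^sup>2"
      using AE_bounds by eventually_elim simp
  qed
  also have "(\<lambda>\<omega>. X \<omega> ^ k * (X \<omega> - c)\<^sup>2) =
      (\<lambda>\<omega>. X \<omega> ^ Suc (Suc k) - 2 * c * X \<omega> ^ Suc k + c\<^sup>2 * X \<omega> ^ k)"
    by (rule ext) (simp add: power2_eq_square algebra_simps)
  also have "expectation \<dots> = m (Suc (Suc k)) - 2 * c * m (Suc k) + c\<^sup>2 * m k"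
    unfolding m_def moment_def
    by (simp add: integrable_power integrable_power[of "Suc k", simplified]
        integrable_power[of "Suc (Suc k)", simplified])
  finally show ?thesis
    using moment_pos[of k] unfolding m_def[symmetric] c_def
    by (simp add: field_simps power2_eq_square)
qed

text \<open>
  Capping the order keeps the only moments that \<open>C_coeff\<close> refers to. It can only increase the
  moments of \<open>X / b\<close>, and the capped sequence is still decreasing and log-convex.
\<close>
definition capped_moment :: "nat \<Rightarrow> nat \<Rightarrow> real" where
  "capped_moment p k = moment M X (min k p) / b ^ min k p"

lemma capped_moment_0 [simp]: "capped_moment p 0 = 1"
  by (simp add: capped_moment_def moment_def prob_space)

lemma capped_moment_pos: "0 < capped_moment p k"
  using moment_pos b_pos by (simp add: capped_moment_def)

lemma capped_moment_Suc_le: "capped_moment p (Suc k) \<le> capped_moment p k"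
proof (cases "k < p")
  case True
  hence "min (Suc k) p = Suc k" "min k p = k" by auto
  thus ?thesis using moment_Suc_le[of k] b_pos by (simp add: capped_moment_def divide_simps mult.commute)
next
  case False
  hence "min (Suc k) p = p" "min k p = p" by auto
  thus ?thesis by (simp add: capped_moment_def)
qed

lemma capped_moment_bounded: "\<bar>capped_moment p k\<bar> \<le> 1"
proof -
  have "capped_moment p k \<le> capped_moment p 0"
    by (rule lift_Suc_antimono_le[of "capped_moment p"]) (simp_all add: capped_moment_Suc_le)
  thus ?thesis using capped_moment_pos[of p k] by simp
qed

lemma capped_moment_log_convex:
  "(capped_moment p (Suc k))\<^sup>2 \<le> capped_moment p k * capped_moment p (Suc (Suc k))"
proof (cases "Suc k < p")
  case True
  hence "min k p = k" "min (Suc k) p = Suc k" "min (Suc (Suc k)) p = Suc (Suc k)" by auto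
  thus ?thesis using moment_log_convex[of k] b_pos
    by (simp add: capped_moment_def power2_eq_square divide_simps mult_ac)
next
  case False
  hence "capped_moment p (Suc (Suc k)) = capped_moment p (Suc k)"
    by (auto simp: capped_moment_def min_def)
  thus ?thesis
    using mult_right_mono[OF capped_moment_Suc_le[of p k], of "capped_moment p (Suc k)"]
      capped_moment_pos[of p "Suc k"] by (simp add: power2_eq_square)
qed

text \<open>
  Replacing the exponent \<open>k\<close> by \<open>min k p\<close> in the exponential series enlarges it pointwise. The
  enlarged series is a finite combination of powers of \<open>X\<close>, so that its expectation needs no exchange
  of limits.
\<close>
lemma mgf_le_egf_capped_moment:
  assumes "0 \<le> y"
  shows "expectation (\<lambda>\<omega>. exp (y * (X \<omega> / b))) \<le> egf (capped_moment p) y"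
proof -
  let ?Z = "\<lambda>\<omega> k. X \<omega> ^ k / b ^ k"
  let ?E = "\<lambda>\<omega>. ?Z \<omega> p * exp y + (\<Sum>j<p. y ^ j / fact j * (?Z \<omega> j - ?Z \<omega> p))"
  have "expectation (\<lambda>\<omega>. exp (y * (X \<omega> / b))) \<le> expectation ?E"
  proof (rule integral_mono_AE)
    show "AE \<omega> in M. exp (y * (X \<omega> / b)) \<le> ?E \<omega>"
      using AE_bounds
    proof eventually_elim
      case (elim \<omega>)
      define z where "z = X \<omega> / b"
      have z: "0 \<le> z" "z \<le> 1" using elim b_pos by (auto simp: z_def)
      have "exp (y * z) = egf (\<lambda>k. z ^ k) y"
        by (simp add: exp_def egf_def power_mult_distrib divide_inverse mult_ac)
      also have "\<dots> \<le> egf (\<lambda>k. z ^ min k p) y"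
        using z assms by (intro egf_mono[of _ 1 _ 1]) (auto intro: power_le_one power_decreasing)
      also have "\<dots> = z ^ p * exp y + (\<Sum>j<p. y ^ j / fact j * (z ^ min j p - z ^ p))"
        by (rule egf_eventually_const) (simp add: min_def)
      also have "\<dots> = ?E \<omega>" by (simp add: z_def power_divide)
      finally show ?case by (simp add: z_def)
    qed
    show "integrable M (\<lambda>\<omega>. exp (y * (X \<omega> / b)))"
      using integrable_exp[of "y / b"] by simp
    show "integrable M ?E"
      by (intro Bochner_Integration.integrable_add Bochner_Integration.integrable_sum
          integrable_mult_left integrable_mult_right Bochner_Integration.integrable_diff
          integrable_divide integrable_power)
  qed
  also have "\<dots> = moment M X p / b ^ p * exp y +
      (\<Sum>j<p. y ^ j / fact j * (moment M X j / b ^ j - moment M X p / b ^ p))"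
    by (simp add: moment_def integrable_power)
  also have "\<dots> = egf (capped_moment p) y"
    by (subst egf_eventually_const[where N = p and c = "moment M X p / b ^ p"])
       (simp_all add: capped_moment_def)
  finally show ?thesis .
qed

text \<open>
  The quotient of the second and the first derivative of the bound on the moment generating function.
\<close>
definition deriv_ratio :: "nat \<Rightarrow> real \<Rightarrow> real" where
  "deriv_ratio p y = egf (\<lambda>k. capped_moment p (Suc (Suc k))) y / egf (\<lambda>k. capped_moment p (Suc k)) y"

text \<open>
  The derivative of order \<open>q\<close> of the moment generating function bound in closed form. For \<open>q = 2\<close> and \<open>q = 1\<close> these
  are the numerator and the denominator of \<open>C_coeff\<close>, up to the common factor \<open>b ^ p\<close>.
\<close>
lemma egf_capped_moment_shift:
  "egf (\<lambda>k. capped_moment p (k + q)) y =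
    (moment M X p * exp y +
      (\<Sum>j<p - q. y ^ j / fact j * (b ^ (p - j - q) * moment M X (j + q) - moment M X p))) / b ^ p"
proof (subst egf_eventually_const[where N = "p - q" and c = "moment M X p / b ^ p"])
  have "capped_moment p (j + q) = b ^ (p - j - q) * moment M X (j + q) / b ^ p" if "j < p - q" for j
  proof -
    have "p = (p - j - q) + (j + q)" using that by simp
    hence "b ^ p = b ^ (p - j - q) * b ^ (j + q)" by (metis power_add)
    moreover have "min (j + q) p = j + q" using that by simp
    ultimately show ?thesis using b_pos by (simp add: capped_moment_def)
  qed
  thus "moment M X p / b ^ p * exp y +
      (\<Sum>j<p - q. y ^ j / fact j * (capped_moment p (j + q) - moment M X p / b ^ p)) =
    (moment M X p * exp y +
      (\<Sum>j<p - q. y ^ j / fact j * (b ^ (p - j - q) * moment M X (j + q) - moment M X p))) / b ^ p"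
    by (simp add: add_divide_distrib diff_divide_distrib[symmetric] sum_divide_distrib mult.commute)
next
  fix k assume "p - q \<le> k"
  hence "min (k + q) p = p" by simp
  thus "capped_moment p (k + q) = moment M X p / b ^ p" by (simp add: capped_moment_def)
qed

lemma C_coeff_eq_deriv_ratio: "C_coeff p y b (moment M X) = (deriv_ratio p y)\<^sup>2"
  using b_pos egf_capped_moment_shift[of p 1 y] egf_capped_moment_shift[of p 2 y]
  by (simp add: C_coeff_def deriv_ratio_def)

lemma deriv_ratio_pos: "0 \<le> y \<Longrightarrow> 0 < deriv_ratio p y"
  unfolding deriv_ratio_def
  by (intro divide_pos_pos egf_pos[of _ 1] capped_moment_bounded capped_moment_pos)

lemma deriv_ratio_le_1:
  assumes "0 \<le> y"
  shows "deriv_ratio p y \<le> 1"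
proof -
  have "egf (\<lambda>k. capped_moment p (Suc (Suc k))) y \<le> egf (\<lambda>k. capped_moment p (Suc k)) y"
    by (intro egf_mono[of _ 1 _ 1] capped_moment_bounded capped_moment_Suc_le assms)
  moreover have "0 < egf (\<lambda>k. capped_moment p (Suc k)) y"
    by (intro egf_pos[of _ 1] capped_moment_bounded capped_moment_pos assms)
  ultimately show ?thesis by (simp add: deriv_ratio_def)
qed

lemma deriv_ratio_mono: "0 \<le> x \<Longrightarrow> x \<le> y \<Longrightarrow> deriv_ratio p x \<le> deriv_ratio p y"
  unfolding deriv_ratio_def
  by (intro egf_ratio_mono[of _ 1] capped_moment_bounded capped_moment_pos capped_moment_log_convex)

lemma C_coeff_pos: "0 \<le> y \<Longrightarrow> 0 < C_coeff p y b (moment M X)"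
  using deriv_ratio_pos[of y p] by (simp add: C_coeff_eq_deriv_ratio)

lemma C_coeff_le_1: "0 \<le> y \<Longrightarrow> C_coeff p y b (moment M X) \<le> 1"
  using deriv_ratio_le_1[of y p] deriv_ratio_pos[of y p] by (simp add: C_coeff_eq_deriv_ratio power_le_one)

lemma C_coeff_mono:
  "0 \<le> x \<Longrightarrow> x \<le> y \<Longrightarrow> C_coeff p x b (moment M X) \<le> C_coeff p y b (moment M X)"
  using deriv_ratio_mono[of x y p] deriv_ratio_pos[of x p] by (simp add: C_coeff_eq_deriv_ratio power_mono)

lemma C_coeff_1: "C_coeff 1 y b (moment M X) = 1"
  using moment_pos[of 1] by (simp add: C_coeff_def)

lemma d_coeff_pos: "0 < d_coeff M X"
  using moment_pos[of 1] moment_pos[of 2] by (simp add: d_coeff_def)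

text \<open>
  By monotonicity it is enough to look at \<open>y = 0\<close>, where the two generating functions reduce to their
  leading coefficients. For \<open>p = 1\<close> the second capped moment is the first one, the quotient is \<open>1\<close>,
  and the claim becomes \<open>E (X\<^sup>2) \<le> b * E X\<close>.
\<close>
lemma d_coeff_le_C_coeff:
  assumes "1 \<le> p" "0 \<le> y"
  shows "d_coeff M X \<le> b\<^sup>2 * C_coeff p y b (moment M X)"
proof -
  let ?m = "moment M X"
  have "?m 2 / ?m 1 \<le> b * deriv_ratio p 0"
  proof (cases "p = 1")
    case True
    hence "deriv_ratio p 0 = 1"
      using moment_pos[of 1] b_pos by (simp add: deriv_ratio_def capped_moment_def)
    thus ?thesis using moment_Suc_le[of 1] moment_pos[of 1]
      by (simp add: pos_divide_le_eq numeral_2_eq_2)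
  next
    case False
    hence "min 2 p = 2" using assms by simp
    thus ?thesis using assms moment_pos[of 1] b_pos
      by (simp add: deriv_ratio_def capped_moment_def numeral_2_eq_2)
  qed
  also have "\<dots> \<le> b * deriv_ratio p y"
    using deriv_ratio_mono[of 0 y p] assms b_pos by simp
  finally have "(?m 2 / ?m 1)\<^sup>2 \<le> (b * deriv_ratio p y)\<^sup>2"
    using moment_pos by (intro power_mono) (auto simp: less_imp_le)
  thus ?thesis using assms by (simp add: d_coeff_def C_coeff_eq_deriv_ratio power_mult_distrib)
qed

text \<open>
  Hoeffding's lemma with the refined variance proxy. Centering cancels the linear term of the
  bound, since the first capped moment is the exact first moment of \<open>X / b\<close>; this uses \<open>p \<ge> 1\<close>.
\<close>
lemma centered_mgf_le:
  assumes "1 \<le> p" "0 < s"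
  shows "expectation (\<lambda>\<omega>. exp (s * (X \<omega> - expectation X)))
    \<le> exp (s\<^sup>2 / 8 * (b\<^sup>2 * C_coeff p (s * b) b (moment M X)))"
proof -
  have E: "s * b * capped_moment p 1 = s * expectation X"
    using assms b_pos by (simp add: capped_moment_def moment_def)
  have "expectation (\<lambda>\<omega>. exp (s * X \<omega>)) \<le> egf (capped_moment p) (s * b)"
    using mgf_le_egf_capped_moment[of "s * b" p] assms b_pos by simp
  also have "\<dots> \<le> exp (capped_moment p 1 * (s * b) + (s * b)\<^sup>2 / 8 * (deriv_ratio p (s * b))\<^sup>2)"
    unfolding deriv_ratio_def
    by (intro egf_le_exp[of _ 1] capped_moment_bounded capped_moment_pos capped_moment_log_convex)
       (use assms b_pos in auto)
  also have "\<dots> = exp (s * expectation X) * exp (s\<^sup>2 / 8 * (b\<^sup>2 * C_coeff p (s * b) b (moment M X)))"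
    using assms E by (simp add: C_coeff_eq_deriv_ratio exp_add[symmetric] power_mult_distrib mult_ac)
  finally have "expectation (\<lambda>\<omega>. exp (s * X \<omega>)) / exp (s * expectation X)
      \<le> exp (s\<^sup>2 / 8 * (b\<^sup>2 * C_coeff p (s * b) b (moment M X)))"
    by (simp add: divide_simps mult.commute)
  moreover have "(\<lambda>\<omega>. exp (s * (X \<omega> - expectation X))) =
      (\<lambda>\<omega>. exp (s * X \<omega>) / exp (s * expectation X))"
    by (rule ext) (simp add: right_diff_distrib exp_diff)
  ultimately show ?thesis by simp
qed

end

section \<open>Tail bounds for sums\<close>

text \<open>
  The coefficient in the exponent depends on the Chernoff parameter \<open>s\<close> itself, so the optimal \<open>s\<close> has no
  closed form. Since \<open>D\<close> is a lower bound for the variance proxy \<open>A\<close>, the value \<open>4 * t / D\<close> dominates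
  the choice \<open>s = 4 * t / A\<close>, and the coefficients may be frozen there.
\<close>
theorem higher_moment_Hoeffding_ineq:
  fixes X :: "'i \<Rightarrow> 'a \<Rightarrow> real" and b :: "'i \<Rightarrow> real"
  assumes "prob_space M" and I: "finite I" "I \<noteq> {}"
    and indep: "prob_space.indep_vars M (\<lambda>_. borel) X I"
    and var: "\<And>i. i \<in> I \<Longrightarrow> nonneg_bounded_variable M (X i) (b i)"
    and p: "1 \<le> p" and t: "0 < t"
  defines "S \<equiv> \<lambda>\<omega>. \<Sum>i\<in>I. X i \<omega>" and "D \<equiv> \<Sum>i\<in>I. d_coeff M (X i)"
  shows "\<P>(\<omega> in M. S \<omega> - prob_space.expectation M S \<ge> t)
    \<le> exp (- (2 * t\<^sup>2) / (\<Sum>i\<in>I. (b i)\<^sup>2 * C_coeff p (4 * t * b i / D) (b i) (moment M (X i))))"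
proof -
  interpret prob_space M by fact
  define C where "C = (\<lambda>i y. C_coeff p y (b i) (moment M (X i)))"
  define A where "A = (\<Sum>i\<in>I. (b i)\<^sup>2 * C i (4 * t * b i / D))"
  have b: "0 < b i" if "i \<in> I" for i
    using nonneg_bounded_variable.b_pos[OF var[OF that]] .
  have D: "0 < D"
    unfolding D_def using I var nonneg_bounded_variable.d_coeff_pos by (intro sum_pos) blast+
  have "D \<le> A"
    unfolding D_def A_def C_def
  proof (rule sum_mono)
    fix i assume "i \<in> I"
    thus "d_coeff M (X i) \<le> (b i)\<^sup>2 * C_coeff p (4 * t * b i / (\<Sum>i\<in>I. d_coeff M (X i))) (b i) (moment M (X i))"
      using nonneg_bounded_variable.d_coeff_le_C_coeff[OF var p] b D t by (simp add: D_def less_imp_le)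
  qed
  hence A: "0 < A" using D by simp
  \<comment> \<open>the minimizer of \<open>- s * t + s\<^sup>2 / 8 * A\<close>, with \<open>A\<close> independent of \<open>s\<close>\<close>
  define s where "s = 4 * t / A"
  have s: "0 < s" "s \<le> 4 * t / D"
    using A D t \<open>D \<le> A\<close> by (auto simp: s_def intro!: divide_left_mono)
  define Y where "Y = (\<lambda>i \<omega>. exp (s * (X i \<omega> - expectation (X i))))"
  have indep_Y: "indep_vars (\<lambda>_. borel) Y I"
    unfolding Y_def by (rule indep_vars_compose2[OF indep]) simp
  have int_X: "integrable M (X i)" if "i \<in> I" for i
    using nonneg_bounded_variable.integrable_power[OF var[OF that], of 1] by simp
  have int_Y: "integrable M (Y i)" if "i \<in> I" for i
  proof -
    have "Y i = (\<lambda>\<omega>. exp (s * X i \<omega>) / exp (s * expectation (X i)))"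
      by (rule ext) (simp add: Y_def right_diff_distrib exp_diff)
    thus ?thesis using nonneg_bounded_variable.integrable_exp[OF var[OF that]] by simp
  qed
  have "expectation S = (\<Sum>i\<in>I. expectation (X i))"
    unfolding S_def using int_X by simp
  hence exp_S: "exp (s * (S \<omega> - expectation S)) = (\<Prod>i\<in>I. Y i \<omega>)" for \<omega>
    using I by (simp add: S_def Y_def sum_subtractf sum_distrib_left right_diff_distrib flip: exp_sum)
  have "expectation (Y i) \<le> exp (s\<^sup>2 / 8 * ((b i)\<^sup>2 * C i (4 * t * b i / D)))" if "i \<in> I" for i
  proof -
    have "s * b i \<le> 4 * t * b i / D"
      using mult_right_mono[OF s(2), of "b i"] b[OF that] by simp
    hence "C i (s * b i) \<le> C i (4 * t * b i / D)"
      unfolding C_def using s b[OF that]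
      by (intro nonneg_bounded_variable.C_coeff_mono[OF var[OF that]]) auto
    hence "exp (s\<^sup>2 / 8 * ((b i)\<^sup>2 * C i (s * b i))) \<le> exp (s\<^sup>2 / 8 * ((b i)\<^sup>2 * C i (4 * t * b i / D)))"
      by (simp add: mult_left_mono)
    thus ?thesis
      using nonneg_bounded_variable.centered_mgf_le[OF var[OF that] p s(1)]
      unfolding Y_def C_def by linarith
  qed
  hence "(\<Prod>i\<in>I. expectation (Y i)) \<le> (\<Prod>i\<in>I. exp (s\<^sup>2 / 8 * ((b i)\<^sup>2 * C i (4 * t * b i / D))))"
    by (intro prod_mono) (auto simp: Y_def)
  also have "\<dots> = exp (s\<^sup>2 / 8 * A)"
    using I by (simp add: A_def exp_sum sum_distrib_left)
  finally have mgf: "expectation (\<lambda>\<omega>. \<Prod>i\<in>I. Y i \<omega>) \<le> exp (s\<^sup>2 / 8 * A)"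
    using indep_vars_lebesgue_integral[OF I(1) indep_Y int_Y] by simp
  have int_prod: "integrable M (\<lambda>\<omega>. \<Prod>i\<in>I. Y i \<omega>)"
    using indep_vars_integrable[OF I(1) indep_Y int_Y] by simp
  have "prob {\<omega> \<in> space M. S \<omega> - expectation S \<ge> t}
      \<le> exp (- s * t) * (\<integral>\<omega>\<in>space M. exp (s * (S \<omega> - expectation S)) \<partial>M)"
  proof (rule Chernoff_ineq_ge[OF s(1)])
    show "set_integrable M (space M) (\<lambda>\<omega>. exp (s * (S \<omega> - expectation S)))"
      unfolding exp_S set_integrable_def by (intro integrable_mult_indicator int_prod) simp
  qed simp
  also have "(\<integral>\<omega>\<in>space M. exp (s * (S \<omega> - expectation S)) \<partial>M) = expectation (\<lambda>\<omega>. \<Prod>i\<in>I. Y i \<omega>)"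
    unfolding exp_S using set_integral_space[OF int_prod] by simp
  also have "exp (- s * t) * \<dots> \<le> exp (- s * t) * exp (s\<^sup>2 / 8 * A)"
    using mgf by (intro mult_left_mono) auto
  also have "\<dots> = exp (- (2 * t\<^sup>2) / A)"
    using A by (simp add: s_def power2_eq_square field_simps flip: exp_add)
  finally show ?thesis by (simp add: A_def C_def)
qed

theorem theorem2:
  fixes M :: "'a measure" and X :: "nat \<Rightarrow> 'a \<Rightarrow> real" and b :: "nat \<Rightarrow> real" and n :: nat
    and S :: "'a \<Rightarrow> real" and D :: real
  assumes "prob_space M"
    and "n \<ge> 1"
    and "prob_space.indep_vars M (\<lambda>_. borel) X {1..n}"
    and "\<And>i. i \<in> {1..n} \<Longrightarrow> b i > 0"
    and "\<And>i. i \<in> {1..n} \<Longrightarrow> \<P>(\<omega> in M. X i \<omega> \<in> {0..b i}) = 1"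
    and "\<And>i. i \<in> {1..n} \<Longrightarrow> \<P>(\<omega> in M. X i \<omega> > 0) > 0"
  defines "S \<equiv> (\<lambda>\<omega>. \<Sum>i=1..n. X i \<omega>)"
    and "D \<equiv> (\<Sum>j=1..n. d_coeff M (X j))"
  shows
    "(\<forall>p\<ge>1. \<forall>t>0.
        \<P>(\<omega> in M. S \<omega> - prob_space.expectation M S \<ge> t)
          \<le> exp (- (2 * t\<^sup>2) /
               (\<Sum>i=1..n. (b i)\<^sup>2 * C_coeff p (4 * t * b i / D) (b i) (moment M (X i))))) \<and>
     (\<forall>p\<ge>1. \<forall>i\<in>{1..n}. \<forall>y>0.
        0 < C_coeff p y (b i) (moment M (X i)) \<and> C_coeff p y (b i) (moment M (X i)) \<le> 1) \<and>
     (\<forall>p\<ge>1. \<forall>t>0.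
        exp (- (2 * t\<^sup>2) /
            (\<Sum>i=1..n. (b i)\<^sup>2 * C_coeff p (4 * t * b i / D) (b i) (moment M (X i))))
          \<le> exp (- (2 * t\<^sup>2) / (\<Sum>i=1..n. (b i)\<^sup>2))) \<and>
     (\<forall>i\<in>{1..n}. \<forall>y>0. C_coeff 1 y (b i) (moment M (X i)) = 1) \<and>
     (\<forall>t>0. \<P>(\<omega> in M. S \<omega> - prob_space.expectation M S \<ge> t)
        \<le> exp (- (2 * t\<^sup>2) / (\<Sum>i=1..n. (b i)\<^sup>2)))"
proof -
  interpret prob_space M by fact
  have var: "nonneg_bounded_variable M (X i) (b i)" if i: "i \<in> {1..n}" for i
  proof
    show [measurable]: "X i \<in> borel_measurable M"
      using assms(3) i by (simp add: indep_vars_def)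
    show "0 < b i" "0 < prob {\<omega> \<in> space M. 0 < X i \<omega>}"
      using assms(4,6) i by auto
    have "AE \<omega> in M. X i \<omega> \<in> {0..b i}"
      using assms(5)[OF i] by (subst (asm) prob_Collect_eq_1) auto
    thus "AE \<omega> in M. 0 \<le> X i \<omega> \<and> X i \<omega> \<le> b i" by simp
  qed
  note C_1 = nonneg_bounded_variable.C_coeff_1[OF var]
  note C_pos = nonneg_bounded_variable.C_coeff_pos[OF var]
  note C_le = nonneg_bounded_variable.C_coeff_le_1[OF var]
  have tail: "\<P>(\<omega> in M. S \<omega> - expectation S \<ge> t)
      \<le> exp (- (2 * t\<^sup>2) / (\<Sum>i=1..n. (b i)\<^sup>2 * C_coeff p (4 * t * b i / D) (b i) (moment M (X i))))"
    if "1 \<le> p" "0 < t" for p t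
    unfolding S_def D_def
    using higher_moment_Hoeffding_ineq[OF assms(1) _ _ assms(3) var that] assms(2) by simp
  have D: "0 < D"
    unfolding D_def using assms(2) nonneg_bounded_variable.d_coeff_pos[OF var]
    by (intro sum_pos) auto
  have tighter: "exp (- (2 * t\<^sup>2) /
        (\<Sum>i=1..n. (b i)\<^sup>2 * C_coeff p (4 * t * b i / D) (b i) (moment M (X i))))
      \<le> exp (- (2 * t\<^sup>2) / (\<Sum>i=1..n. (b i)\<^sup>2))" if "0 < t" for p t
  proof -
    let ?A = "\<Sum>i=1..n. (b i)\<^sup>2 * C_coeff p (4 * t * b i / D) (b i) (moment M (X i))"
    have y: "0 \<le> 4 * t * b i / D" if "i \<in> {1..n}" for i
      using assms(4)[OF that] D \<open>0 < t\<close> by simp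
    have "0 < ?A"
    proof (intro sum_pos mult_pos_pos)
      fix i assume i: "i \<in> {1..n}"
      show "0 < (b i)\<^sup>2" "0 < C_coeff p (4 * t * b i / D) (b i) (moment M (X i))"
        using assms(4)[OF i] C_pos[OF i y[OF i]] by auto
    qed (use assms(2) in auto)
    moreover have "?A \<le> (\<Sum>i=1..n. (b i)\<^sup>2)"
      using C_le y by (intro sum_mono mult_left_le) auto
    ultimately show ?thesis
      by (simp add: divide_left_mono)
  qed
  have "\<P>(\<omega> in M. S \<omega> - expectation S \<ge> t) \<le> exp (- (2 * t\<^sup>2) / (\<Sum>i=1..n. (b i)\<^sup>2))"
    if "0 < t" for t
    using order_trans[OF tail tighter, of 1 t] that by simp
  with tail tighter show ?thesis
    using C_pos C_le C_1 by (simp add: less_imp_le)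
qed

end
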